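(* Let $p,r\in[0,1]$ and let $(e(i,t))_{i\in\mathbb Z,t\in\mathbb N}\sim\mathcal L(\mathrm{PM}(1/2);p,r)$. Then for every $t\in\mathbb N$, $(e(i,t):i\in\mathbb Z)\sim\mathrm{PM}(1/2)$.
   Context: $\mathbb N=\{0,1,2,\dots\}$. $\mathrm{PM}(1/2)$ is the law on $\{0,1\}^{\mathbb Z}$ of i.i.d. Bernoulli$(1/2)$ variables indexed by $\mathbb Z$. The law $\mathcal L(\mu;p,r)$, for $\mu$ a probability measure on $\{0,1\}^{\mathbb Z}$ and $p,r\in[0,1]$, is the law of the random field $(e(i,t))_{i\in\mathbb Z,t\in\mathbb N}\in\{0,1\}^{\mathbb Z\times\mathbb N}$ such that $(e(i,0))_{i\in\mathbb Z}\sim\mu$ and $(e(\cdot,t))_{t\ge0}$ is a Markov chain such that, given line $t$, independently for all $i\in\mathbb Z$ with $i+t$ even, the pair $(e(i,t+1),e(i+1,t+1))$ depends only on $(e(i,t),e(i+1,t))$, with, for $k\in\{0,1\}$: $(k,k)\mapsto(k,k)$ with probability $r$ and $(k,k)\mapsto(1-k,1-k)$ with probability $1-r$; $(k,1-k)\mapsto(1-k,k)$ with probability $p$ and $(k,1-k)\mapsto(k,1-k)$ with probability $1-p$. *)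

theory Defs
  imports "HOL-Probability.Probability"
begin

text \<open>The alphabet \<open>{0,1}\<close> is \<^typ>\<open>bool\<close>, with \<open>1 = True\<close> and \<open>1 - k = (\<not> k)\<close>.
  A line is an element of \<open>{0,1}\<^sup>\<int>\<close> with the product sigma-algebra.\<close>

definition line_space :: "(int \<Rightarrow> bool) measure" where
  "line_space = (\<Pi>\<^sub>M i\<in>(UNIV :: int set). count_space (UNIV :: bool set))"

definition PM :: "real \<Rightarrow> (int \<Rightarrow> bool) measure" where
  "PM q = (\<Pi>\<^sub>M i\<in>(UNIV :: int set). measure_pmf (bernoulli_pmf q))"

definition local_rule :: "real \<Rightarrow> real \<Rightarrow> bool \<times> bool \<Rightarrow> (bool \<times> bool) pmf" where
  "local_rule p r = (\<lambda>(a, b).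
     if a = b
     then map_pmf (\<lambda>stay. if stay then (a, b) else (\<not> a, \<not> b)) (bernoulli_pmf r)
     else map_pmf (\<lambda>swap. if swap then (b, a) else (a, b)) (bernoulli_pmf p))"

text \<open>The law of line \<open>t + 1\<close> given that line \<open>t\<close> is \<open>x\<close>. The component \<open>w i\<close> of the product,
  for \<open>i + t\<close> even, is the new pair at sites \<open>(i, i + 1)\<close>; a site \<open>i\<close> with \<open>i + t\<close> odd is
  therefore the second site of the pair with index \<open>i - 1\<close>.\<close>

definition step_kernel ::
    "real \<Rightarrow> real \<Rightarrow> nat \<Rightarrow> (int \<Rightarrow> bool) \<Rightarrow> (int \<Rightarrow> bool) measure" where
  "step_kernel p r t x =
     distr (\<Pi>\<^sub>M i\<in>{i. even (i + int t)}. measure_pmf (local_rule p r (x i, x (i + 1))))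
       line_space
       (\<lambda>w i. if even (i + int t) then fst (w i) else snd (w (i - 1)))"

definition line :: "(int \<Rightarrow> nat \<Rightarrow> 'a \<Rightarrow> bool) \<Rightarrow> nat \<Rightarrow> 'a \<Rightarrow> int \<Rightarrow> bool" where
  "line e t \<omega> = (\<lambda>i. e i t \<omega>)"

text \<open>The sigma-algebra on \<open>space M\<close> generated by lines \<open>0, \<dots>, t\<close>.\<close>

definition history ::
    "'a measure \<Rightarrow> (int \<Rightarrow> nat \<Rightarrow> 'a \<Rightarrow> bool) \<Rightarrow> nat \<Rightarrow> 'a measure" where
  "history M e t =
     vimage_algebra (space M) (\<lambda>\<omega>. \<lambda>s\<in>{..t}. line e s \<omega>) (\<Pi>\<^sub>M s\<in>{..t}. line_space)"

text \<open>The field \<open>e\<close>, defined on the probability space \<open>M\<close>, has law \<open>\<L>(\<mu>; p, r)\<close>: the initial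
  line has law \<open>\<mu>\<close>, and the conditional law of line \<open>t + 1\<close> given lines \<open>0, \<dots>, t\<close> is
  \<open>step_kernel p r t\<close> evaluated at line \<open>t\<close>.\<close>

definition has_field_law ::
    "'a measure \<Rightarrow> (int \<Rightarrow> nat \<Rightarrow> 'a \<Rightarrow> bool) \<Rightarrow> (int \<Rightarrow> bool) measure \<Rightarrow> real \<Rightarrow> real \<Rightarrow> bool" where
  "has_field_law M e \<mu> p r \<longleftrightarrow>
     prob_space M \<and>
     (\<forall>i t. e i t \<in> measurable M (count_space UNIV)) \<and>
     distr M line_space (line e 0) = \<mu> \<and>
     (\<forall>t. \<forall>B \<in> sets line_space.
        AE \<omega> in M.
          real_cond_exp M (history M e t) (indicator {\<omega> \<in> space M. line e (Suc t) \<omega> \<in> B}) \<omega>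
          = measure (step_kernel p r t (line e t \<omega>)) B)"

end

theory Submission imports Defs begin

text \<open>Group the sites of line \<open>t\<close> into the pairs \<open>{i, i + 1}\<close>, \<open>i + t\<close> even, on which the
  dynamics acts. Under \<open>PM (1/2)\<close> the pairs are i.i.d. uniform on \<open>{0,1}\<^sup>2\<close>, and given line \<open>t\<close> they
  are updated independently. The local rule picks at random one of four permutations of \<open>{0,1}\<^sup>2\<close>,
  hence preserves the uniform law. So line \<open>t + 1\<close> again consists of i.i.d. uniform pairs.\<close>

section \<open>Lines assembled from independent pairs\<close>

definition pair_sites :: "nat \<Rightarrow> int set" where
  "pair_sites t = {i. even (i + int t)}"

definition line_of_pairs :: "nat \<Rightarrow> (int \<Rightarrow> bool \<times> bool) \<Rightarrow> int \<Rightarrow> bool" where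
  "line_of_pairs t w = (\<lambda>i. if even (i + int t) then fst (w i) else snd (w (i - 1)))"

text \<open>The pair laws may vary with the site so that one object covers both measures to be
  compared: the transition law, whose pair laws depend on the previous line, and the Bernoulli line,
  whose pair law is constant.\<close>

definition indep_pairs :: "nat \<Rightarrow> (int \<Rightarrow> (bool \<times> bool) pmf) \<Rightarrow> (int \<Rightarrow> bool) measure" where
  "indep_pairs t P =
     distr (\<Pi>\<^sub>M i\<in>pair_sites t. measure_pmf (P i)) line_space (line_of_pairs t)"

lemma step_kernel_eq_indep_pairs:
  "step_kernel p r t x = indep_pairs t (\<lambda>i. local_rule p r (x i, x (i + 1)))"
  by (simp add: step_kernel_def indep_pairs_def pair_sites_def line_of_pairs_def [abs_def])

lemma space_line_space [simp]: "space line_space = UNIV"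
  by (simp add: line_space_def space_PiM)

lemma measurable_line_space_component [measurable]:
  "(\<lambda>x. x i) \<in> measurable line_space (count_space UNIV)"
  unfolding line_space_def by (rule measurable_component_singleton) simp

lemma sets_PM [simp, measurable_cong]: "sets (PM q) = sets line_space"
  unfolding PM_def line_space_def by (rule sets_PiM_cong) simp_all

lemma line_of_pairs_pair:
  "i \<in> pair_sites t \<Longrightarrow> (line_of_pairs t w i, line_of_pairs t w (i + 1)) = w i"
  by (simp add: line_of_pairs_def pair_sites_def)

lemma measurable_pmf_component [measurable (raw)]:
  "i \<in> I \<Longrightarrow> (\<lambda>w. w i) \<in> measurable (\<Pi>\<^sub>M i\<in>I. measure_pmf (P i)) (count_space UNIV)"
  using measurable_component_singleton[of i I "\<lambda>i. measure_pmf (P i)"] by simp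

lemma measurable_line_of_pairs [measurable]:
  "line_of_pairs t \<in> measurable (\<Pi>\<^sub>M i\<in>pair_sites t. measure_pmf (P i)) line_space"
  unfolding line_space_def
proof (rule measurable_PiM_single')
  fix i :: int
  \<comment> \<open>\<open>j\<close> is the index of the pair containing site \<open>i\<close>;
    parity decides which entry of that pair is read.\<close>
  define j where "j = (if even (i + int t) then i else i - 1)"
  have "j \<in> pair_sites t" by (auto simp: j_def pair_sites_def)
  note [measurable] = measurable_pmf_component[OF this]
  show "(\<lambda>w. line_of_pairs t w i) \<in>
      measurable (\<Pi>\<^sub>M i\<in>pair_sites t. measure_pmf (P i)) (count_space UNIV)"
  proof (cases "even (i + int t)")
    case True
    have "(\<lambda>w. fst (w j)) \<in> measurable (\<Pi>\<^sub>M i\<in>pair_sites t. measure_pmf (P i)) (count_space UNIV)"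
      by measurable
    then show ?thesis using True by (simp add: line_of_pairs_def j_def)
  next
    case False
    have "(\<lambda>w. snd (w j)) \<in> measurable (\<Pi>\<^sub>M i\<in>pair_sites t. measure_pmf (P i)) (count_space UNIV)"
      by measurable
    then show ?thesis using False by (simp add: line_of_pairs_def j_def)
  qed
qed simp

lemma pair_cylinder_measurable [measurable]:
  fixes S :: "int \<Rightarrow> (bool \<times> bool) set"
  assumes "finite K"
  shows "{x. \<forall>i\<in>K. (x i, x (i + 1)) \<in> S i} \<in> sets line_space"
proof -
  have "{x\<in>space line_space. \<forall>i\<in>K. (x i, x (i + 1)) \<in> S i} \<in> sets line_space"
    using assms by measurable
  then show ?thesis by simp
qed

section \<open>Product formulas for finitely many pairs\<close>

lemma nn_integral_PiM_prod_finite: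
  fixes f :: "'i \<Rightarrow> 'b \<Rightarrow> ennreal"
  assumes K: "finite K" "K \<subseteq> I"
  shows "(\<integral>\<^sup>+ w. (\<Prod>i\<in>K. f i (w i)) \<partial>(\<Pi>\<^sub>M i\<in>I. measure_pmf (P i)))
    = (\<Prod>i\<in>K. \<integral>\<^sup>+ y. f i y \<partial>measure_pmf (P i))"
proof -
  let ?M = "\<lambda>i. measure_pmf (P i)"
  interpret product_prob_space ?M I
    by unfold_locales
  have [measurable]: "(\<lambda>v. \<Prod>i\<in>K. f i (v i)) \<in> borel_measurable (PiM K ?M)"
    by (intro borel_measurable_prod_ennreal measurable_compose[OF measurable_pmf_component]) auto
  \<comment> \<open>The integrand sees only coordinates in \<open>K\<close>, so the integral passes
    to the marginal on the finite product over \<open>K\<close>.\<close>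
  have "(\<integral>\<^sup>+ w. (\<Prod>i\<in>K. f i (w i)) \<partial>(PiM I ?M)) =
      (\<integral>\<^sup>+ w. (\<Prod>i\<in>K. f i (restrict w K i)) \<partial>(PiM I ?M))"
    by simp
  also have "\<dots> = (\<integral>\<^sup>+ v. (\<Prod>i\<in>K. f i (v i)) \<partial>distr (PiM I ?M) (PiM K ?M) (\<lambda>w. restrict w K))"
    using K by (subst nn_integral_distr) (auto intro!: measurable_restrict_subset)
  also have "\<dots> = (\<integral>\<^sup>+ v. (\<Prod>i\<in>K. f i (v i)) \<partial>PiM K ?M)"
    using K by (subst distr_PiM_restrict_finite) auto
  also have "\<dots> = (\<Prod>i\<in>K. \<integral>\<^sup>+ y. f i y \<partial>?M i)"
    using K by (intro product_nn_integral_prod) auto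
  finally show ?thesis .
qed

text \<open>General factors \<open>f i\<close> are allowed, not only indicators: the probability
  that a pair is updated into a given set is itself a function of the old pair, and it has to be
  averaged as well.\<close>

lemma nn_integral_indep_pairs:
  fixes f :: "int \<Rightarrow> bool \<times> bool \<Rightarrow> ennreal"
  assumes K: "finite K" "K \<subseteq> pair_sites t"
  shows "(\<integral>\<^sup>+ x. (\<Prod>i\<in>K. f i (x i, x (i + 1))) \<partial>indep_pairs t P)
    = (\<Prod>i\<in>K. \<integral>\<^sup>+ y. f i y \<partial>measure_pmf (P i))"
proof -
  have [measurable]: "(\<lambda>x. f i (x i, x (i + 1))) \<in> borel_measurable line_space" for i
    by measurable
  have "(\<integral>\<^sup>+ x. (\<Prod>i\<in>K. f i (x i, x (i + 1))) \<partial>indep_pairs t P)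
    = (\<integral>\<^sup>+ w. (\<Prod>i\<in>K. f i (w i)) \<partial>(\<Pi>\<^sub>M i\<in>pair_sites t. measure_pmf (P i)))"
    unfolding indep_pairs_def
    using K by (subst nn_integral_distr)
      (auto intro!: nn_integral_cong prod.cong simp: line_of_pairs_pair subset_eq)
  then show ?thesis
    using nn_integral_PiM_prod_finite[OF K] by simp
qed

lemma emeasure_indep_pairs_cylinder:
  assumes K: "finite K" "K \<subseteq> pair_sites t"
  shows "emeasure (indep_pairs t P) {x. \<forall>i\<in>K. (x i, x (i + 1)) \<in> S i}
    = (\<Prod>i\<in>K. emeasure (measure_pmf (P i)) (S i))"
proof -
  let ?C = "{x. \<forall>i\<in>K. (x i, x (i + 1)) \<in> S i}"
  have C: "?C \<in> sets (indep_pairs t P)"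
    using K by (simp add: indep_pairs_def pair_cylinder_measurable)
  have "indicator ?C x = (\<Prod>i\<in>K. indicator (S i) (x i, x (i + 1)) :: ennreal)" for x
    using K(1) by (auto simp: indicator_def prod_zero)
  then have "emeasure (indep_pairs t P) ?C
      = (\<integral>\<^sup>+ x. (\<Prod>i\<in>K. indicator (S i) (x i, x (i + 1))) \<partial>indep_pairs t P)"
    by (simp only: nn_integral_indicator[OF C, symmetric])
  also have "\<dots> = (\<Prod>i\<in>K. emeasure (measure_pmf (P i)) (S i))"
    by (subst nn_integral_indep_pairs[OF K]) simp
  finally show ?thesis .
qed

section \<open>Laws of lines: total mass, a criterion for equality, the Bernoulli case\<close>

lemma prob_space_indep_pairs: "prob_space (indep_pairs t P)"
  unfolding indep_pairs_def
  by (intro prob_space.prob_space_distr prob_space_PiM measurable_line_of_pairs prob_space_measure_pmf)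

lemma prob_space_PM: "prob_space (PM q)"
  unfolding PM_def by (intro prob_space_PiM prob_space_measure_pmf)

text \<open>Finite-dimensional cylinders generate the product sigma-algebra and are stable under
  intersection. Each of them becomes a cylinder over whole pairs once its finite set of sites is
  completed to a union of pairs.\<close>

lemma line_measure_eqI:
  assumes sets: "sets P = sets line_space" "sets Q = sets line_space"
    and "finite_measure P"
    and eq: "\<And>K A. finite K \<Longrightarrow> K \<subseteq> pair_sites t \<Longrightarrow>
      emeasure P {x. \<forall>i\<in>K. (x i, x (i + 1)) \<in> A i \<times> A (i + 1)} =
      emeasure Q {x. \<forall>i\<in>K. (x i, x (i + 1)) \<in> A i \<times> A (i + 1)}"
  shows "P = Q"
proof (rule measure_eqI_PiM_infinite[OF sets[unfolded line_space_def] _ \<open>finite_measure P\<close>])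
  fix A :: "int \<Rightarrow> bool set" and J :: "int set"
  assume "finite J"
  let ?j = "\<lambda>i. if even (i + int t) then i else i - 1"
  \<comment> \<open>A pair may meet \<open>J\<close> in one site only; its other site stays
    unconstrained.\<close>
  let ?A = "\<lambda>i. if i \<in> J then A i else UNIV"
  let ?K = "?j ` J"
  have "{x. \<forall>i\<in>?K. (x i, x (i + 1)) \<in> ?A i \<times> ?A (i + 1)} = {x. \<forall>i\<in>J. x i \<in> A i}"
  proof (intro set_eqI iffI CollectI ballI)
    fix x i assume x: "x \<in> {x. \<forall>i\<in>?K. (x i, x (i + 1)) \<in> ?A i \<times> ?A (i + 1)}" and "i \<in> J"
    then have "(x (?j i), x (?j i + 1)) \<in> ?A (?j i) \<times> ?A (?j i + 1)" by blast
    with \<open>i \<in> J\<close> show "x i \<in> A i" by (simp split: if_splits)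
  qed auto
  also have "\<dots> = prod_emb UNIV (\<lambda>_. count_space UNIV) J (Pi\<^sub>E J A)"
    by (auto simp: prod_emb_def)
  finally have "prod_emb UNIV (\<lambda>_. count_space UNIV) J (Pi\<^sub>E J A) =
    {x. \<forall>i\<in>?K. (x i, x (i + 1)) \<in> ?A i \<times> ?A (i + 1)}" ..
  moreover have "finite ?K" "?K \<subseteq> pair_sites t"
    using \<open>finite J\<close> by (auto simp: pair_sites_def)
  ultimately show "emeasure P (prod_emb UNIV (\<lambda>_. count_space UNIV) J (Pi\<^sub>E J A)) =
      emeasure Q (prod_emb UNIV (\<lambda>_. count_space UNIV) J (Pi\<^sub>E J A))"
    using eq[of ?K ?A] by simp
qed

lemma emeasure_pair_pmf_Times:
  "emeasure (measure_pmf (pair_pmf P Q)) (A \<times> B) =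
    emeasure (measure_pmf P) A * emeasure (measure_pmf Q) B"
proof -
  have "emeasure (measure_pmf (pair_pmf P Q)) (A \<times> B) =
      (\<integral>\<^sup>+ (x, y). indicator A x * indicator B y \<partial>measure_pmf (pair_pmf P Q))"
    by (simp only: nn_integral_indicator [symmetric] sets_measure_pmf UNIV_I case_prod_beta'
        indicator_times)
  also have "\<dots> = emeasure (measure_pmf P) A * emeasure (measure_pmf Q) B"
    by (simp add: nn_integral_pair_pmf' nn_integral_cmult nn_integral_multc)
  finally show ?thesis .
qed

text \<open>Grouping independent sites into disjoint pairs gives independent pairs. This holds for
  the pairing of either parity, as is required because the pairing alternates in time.\<close>

lemma PM_eq_indep_pairs:
  "PM q = indep_pairs t (\<lambda>_. pair_pmf (bernoulli_pmf q) (bernoulli_pmf q))"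
proof (rule line_measure_eqI[where t = t])
  interpret product_prob_space "\<lambda>_. measure_pmf (bernoulli_pmf q)" "UNIV :: int set"
    by unfold_locales
  let ?b = "\<lambda>A. emeasure (measure_pmf (bernoulli_pmf q)) A"
  fix K :: "int set" and A :: "int \<Rightarrow> bool set"
  assume K: "finite K" "K \<subseteq> pair_sites t"
  let ?J = "K \<union> (\<lambda>i. i + 1) ` K"
  \<comment> \<open>All first sites have the same parity, so no second site is a first site.\<close>
  have disj: "K \<inter> (\<lambda>i. i + 1) ` K = {}"
  proof -
    have "i + 1 \<notin> K" if "i \<in> K" for i
      using that subsetD[OF K(2), of i] subsetD[OF K(2), of "i + 1"]
      by (auto simp: pair_sites_def)
    then show ?thesis by auto
  qed
  have "emeasure (PM q) {x. \<forall>i\<in>K. (x i, x (i + 1)) \<in> A i \<times> A (i + 1)} =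
      emeasure (PM q) {x\<in>space (PM q). \<forall>i\<in>?J. x i \<in> A i}"
    by (rule arg_cong[where f = "emeasure (PM q)"]) (auto simp: PM_def space_PiM)
  also have "\<dots> = (\<Prod>i\<in>?J. ?b (A i))"
    unfolding PM_def using K by (subst emeasure_PiM_Collect) auto
  also have "\<dots> = (\<Prod>i\<in>K. ?b (A i) * ?b (A (i + 1)))"
    using K(1) disj by (simp add: prod.union_disjoint prod.reindex prod.distrib)
  also have "\<dots> = emeasure (indep_pairs t (\<lambda>_. pair_pmf (bernoulli_pmf q) (bernoulli_pmf q)))
      {x. \<forall>i\<in>K. (x i, x (i + 1)) \<in> A i \<times> A (i + 1)}"
    by (subst emeasure_indep_pairs_cylinder[OF K]) (simp add: emeasure_pair_pmf_Times)
  finally show "emeasure (PM q) {x. \<forall>i\<in>K. (x i, x (i + 1)) \<in> A i \<times> A (i + 1)} =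
      emeasure (indep_pairs t (\<lambda>_. pair_pmf (bernoulli_pmf q) (bernoulli_pmf q)))
      {x. \<forall>i\<in>K. (x i, x (i + 1)) \<in> A i \<times> A (i + 1)}" .
next
  show "finite_measure (PM q)"
    using prob_space_PM by (simp add: prob_space_def)
qed (simp_all add: indep_pairs_def)

section \<open>Invariance under the local rule and under one step\<close>

abbreviation uniform_pair :: "(bool \<times> bool) pmf" where
  "uniform_pair \<equiv> pair_pmf (bernoulli_pmf (1/2)) (bernoulli_pmf (1/2))"

text \<open>The parameter \<open>1/2\<close> enters here: all four pairs have mass 1/4, so every
  bijection of the pairs preserves the law.\<close>

lemma uniform_pair_eq: "uniform_pair = pmf_of_set UNIV"
proof (rule pmf_eqI)
  fix y :: "bool \<times> bool"
  show "pmf uniform_pair y = pmf (pmf_of_set UNIV) y"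
    by (cases y) (auto simp: pmf_pair)
qed

lemma bind_uniform_pair_local_rule: "bind_pmf uniform_pair (local_rule p r) = uniform_pair"
proof -
  \<comment> \<open>Both coins are tossed in advance, whichever case occurs; for fixed coins the
    update is a deterministic involution.\<close>
  define f where "f stay swap = (\<lambda>(a, b). if a = b then if stay then (a, b) else (\<not> a, \<not> b)
    else if swap then (b, a) else (a, b))" for stay swap :: bool
  have "f stay swap (f stay swap y) = y" for stay swap y
    by (auto simp: f_def split: prod.splits)
  then have "bij (f stay swap)" for stay swap
    by (metis bij_betw_byWitness subset_UNIV)
  then have f: "map_pmf (f stay swap) uniform_pair = uniform_pair" for stay swap
    by (simp add: uniform_pair_eq map_pmf_of_set_bij_betw)
  \<comment> \<open>For a given pair only one coin matters, and the other integrates out.\<close>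
  have "local_rule p r y = bind_pmf (bernoulli_pmf r) (\<lambda>stay.
      bind_pmf (bernoulli_pmf p) (\<lambda>swap. return_pmf (f stay swap y)))" for y
    by (cases y) (simp add: local_rule_def f_def map_pmf_def)
  then have "bind_pmf uniform_pair (local_rule p r) = bind_pmf uniform_pair (\<lambda>y.
      bind_pmf (bernoulli_pmf r) (\<lambda>stay. bind_pmf (bernoulli_pmf p) (\<lambda>swap.
        return_pmf (f stay swap y))))"
    by presburger
  \<comment> \<open>The coins are independent of the pair, so the draw of the pair can be moved
    innermost, where \<open>f\<close> applies for each outcome of the coins.\<close>
  also have "\<dots> = bind_pmf (bernoulli_pmf r) (\<lambda>stay. bind_pmf (bernoulli_pmf p) (\<lambda>swap.
      map_pmf (f stay swap) uniform_pair))"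
    unfolding map_pmf_def
    by (subst bind_commute_pmf, subst (2) bind_commute_pmf) (rule refl)
  also have "\<dots> = uniform_pair"
    by (simp only: f bind_pmf_const)
  finally show ?thesis .
qed

text \<open>Given the old line, the cylinder probability is a product whose factor at
  \<open>i\<close> depends only on the old pair at \<open>i\<close>. Old pairs are independent, so
  the average factorises, and each factor is an average of the local rule over the uniform
  pair.\<close>

lemma nn_integral_step_kernel_cylinder:
  assumes K: "finite K" "K \<subseteq> pair_sites t"
  shows "(\<integral>\<^sup>+ x. emeasure (step_kernel p r t x) {y. \<forall>i\<in>K. (y i, y (i + 1)) \<in> S i} \<partial>PM (1/2))
    = emeasure (PM (1/2)) {y. \<forall>i\<in>K. (y i, y (i + 1)) \<in> S i}"
proof -
  have "(\<integral>\<^sup>+ x. emeasure (step_kernel p r t x) {y. \<forall>i\<in>K. (y i, y (i + 1)) \<in> S i} \<partial>PM (1/2))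
    = (\<Prod>i\<in>K. \<integral>\<^sup>+ y. emeasure (measure_pmf (local_rule p r y)) (S i) \<partial>measure_pmf uniform_pair)"
    unfolding step_kernel_eq_indep_pairs emeasure_indep_pairs_cylinder[OF K]
      PM_eq_indep_pairs[of "1/2" t]
    by (rule nn_integral_indep_pairs[OF K])
  also have "\<dots> = (\<Prod>i\<in>K. emeasure (measure_pmf (bind_pmf uniform_pair (local_rule p r))) (S i))"
    by simp
  also have "\<dots> = emeasure (PM (1/2)) {y. \<forall>i\<in>K. (y i, y (i + 1)) \<in> S i}"
    unfolding PM_eq_indep_pairs[of "1/2" t] emeasure_indep_pairs_cylinder[OF K]
      bind_uniform_pair_local_rule ..
  finally show ?thesis .
qed

section \<open>From the conditional laws to the law of each line\<close>

lemma measurable_line: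
  assumes "has_field_law M e \<mu> p r"
  shows "line e t \<in> measurable M line_space"
  unfolding line_space_def
  by (rule measurable_PiM_single') (use assms in \<open>auto simp: has_field_law_def line_def\<close>)

text \<open>The mean of a conditional probability is the probability of the event, and the field law
  identifies that conditional probability almost everywhere with the kernel.\<close>

lemma emeasure_line_Suc:
  assumes law: "has_field_law M e \<mu> p r" and B: "B \<in> sets line_space"
  shows "emeasure M {\<omega>\<in>space M. line e (Suc t) \<omega> \<in> B} =
    (\<integral>\<^sup>+ \<omega>. emeasure (step_kernel p r t (line e t \<omega>)) B \<partial>M)"
proof -
  interpret prob_space M using law by (simp add: has_field_law_def)
  note [measurable] = measurable_line[OF law] B
  \<comment> \<open>Measurability of the past makes the history a sub-sigma-algebra of
    \<open>M\<close>, as conditional expectation requires.\<close>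
  have "(\<lambda>\<omega>. \<lambda>s\<in>{..t}. line e s \<omega>) \<in> measurable M (\<Pi>\<^sub>M s\<in>{..t}. line_space)"
    by measurable
  then have "sets (history M e t) \<subseteq> sets M"
    unfolding history_def by (subst sets_vimage_algebra2) (auto simp: measurable_def)
  then interpret finite_measure_subalgebra M "history M e t"
    by unfold_locales (simp add: subalgebra_def history_def)
  let ?E = "{\<omega>\<in>space M. line e (Suc t) \<omega> \<in> B}"
  let ?g = "real_cond_exp M (history M e t) (indicator ?E)"
  have E: "integrable M (indicator ?E :: 'a \<Rightarrow> real)"
    by (simp add: integrable_indicator_iff less_top [symmetric])
  have ae: "AE \<omega> in M. ?g \<omega> = measure (step_kernel p r t (line e t \<omega>)) B"
    using law B by (simp add: has_field_law_def)
  have "emeasure M ?E = ennreal (\<integral>\<omega>. ?g \<omega> \<partial>M)"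
    using real_cond_exp_int(2)[OF E] by (simp add: emeasure_eq_measure)
  \<comment> \<open>By \<open>ae\<close>, \<open>?g\<close> is almost everywhere a value of a
    measure, hence nonnegative.\<close>
  also have "\<dots> = (\<integral>\<^sup>+ \<omega>. ennreal (?g \<omega>) \<partial>M)"
    using real_cond_exp_int(1)[OF E] ae by (intro nn_integral_eq_integral [symmetric]) auto
  also have "\<dots> = (\<integral>\<^sup>+ \<omega>. emeasure (step_kernel p r t (line e t \<omega>)) B \<partial>M)"
    using ae prob_space_indep_pairs
    by (intro nn_integral_cong_AE)
      (auto simp: step_kernel_eq_indep_pairs finite_measure.emeasure_eq_measure prob_space_def)
  finally show ?thesis .
qed

theorem proposition1p5:
  fixes M :: "'a measure" and e :: "int \<Rightarrow> nat \<Rightarrow> 'a \<Rightarrow> bool" and p r :: real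
  assumes "p \<in> {0..1}" and "r \<in> {0..1}"
    and "has_field_law M e (PM (1/2)) p r"
  shows "\<forall>t. distr M line_space (line e t) = PM (1/2)"
proof
  fix t
  note law = assms(3)
  note line_meas [measurable] = measurable_line[OF law]
  interpret prob_space M using law by (simp add: has_field_law_def)
  show "distr M line_space (line e t) = PM (1/2)"
  proof (induction t)
    case 0
    show ?case using law by (simp add: has_field_law_def)
  next
    case (Suc t)
    show ?case
    \<comment> \<open>Line \<open>Suc t\<close> is tested on the pairing of time \<open>t\<close>:
      these are the pairs just updated, on which the kernel factorises.\<close>
    proof (rule line_measure_eqI[where t = t])
      show "finite_measure (distr M line_space (line e (Suc t)))"
        by (intro finite_measure_distr line_meas)
    next
      fix K :: "int set" and A :: "int \<Rightarrow> bool set"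
      assume K: "finite K" "K \<subseteq> pair_sites t"
      define C where "C = {x. \<forall>i\<in>K. (x i, x (i + 1)) \<in> A i \<times> A (i + 1)}"
      have C [measurable]: "C \<in> sets line_space"
        unfolding C_def by (rule pair_cylinder_measurable[OF K(1)])
      \<comment> \<open>On a pair cylinder the kernel is a finite product of functions of single
        pairs of \<open>x\<close>, which gives measurability in \<open>x\<close>.\<close>
      have kernel [measurable]: "(\<lambda>x. emeasure (step_kernel p r t x) C) \<in> borel_measurable line_space"
        unfolding step_kernel_eq_indep_pairs C_def emeasure_indep_pairs_cylinder[OF K]
        by measurable
      have "emeasure (distr M line_space (line e (Suc t))) C =
          emeasure M {\<omega>\<in>space M. line e (Suc t) \<omega> \<in> C}"
        by (subst emeasure_distr) (auto intro!: arg_cong[where f = "emeasure M"])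
      also have "\<dots> = (\<integral>\<^sup>+ \<omega>. emeasure (step_kernel p r t (line e t \<omega>)) C \<partial>M)"
        by (rule emeasure_line_Suc[OF law C])
      also have "\<dots> = (\<integral>\<^sup>+ x. emeasure (step_kernel p r t x) C \<partial>distr M line_space (line e t))"
        by (rule nn_integral_distr[symmetric]) (simp_all add: line_meas kernel)
      \<comment> \<open>The induction hypothesis replaces the law of line \<open>t\<close> by
        \<open>PM (1/2)\<close>; what remains is one-step invariance on cylinders.\<close>
      also have "\<dots> = emeasure (PM (1/2)) C"
        unfolding Suc.IH C_def by (rule nn_integral_step_kernel_cylinder[OF K])
      finally show "emeasure (distr M line_space (line e (Suc t)))
          {x. \<forall>i\<in>K. (x i, x (i + 1)) \<in> A i \<times> A (i + 1)} =
        emeasure (PM (1/2)) {x. \<forall>i\<in>K. (x i, x (i + 1)) \<in> A i \<times> A (i + 1)}"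
        unfolding C_def .
    qed simp_all
  qed
qed

end
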